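(* (a) In any $*$-continuous BiKAT $\ddot{\mathbb A}$ over a KAT $\mathbb A$, for all tests $e,e'\in\mathbb B$, actions $c,c'\in\mathbb A$ and bitests $Q,R\in\ddot{\mathbb B}$: \[ \langle e;c]^*;\langle\neg e];[e';c'\rangle^*;[\neg e'\rangle = \big(Q;\langle e;c] + R;[e';c'\rangle + \neg Q;\neg R;\langle e;c\mid e';c'\rangle + \neg Q;\langle e;c\mid\neg e'\rangle + \neg R;\langle\neg e\mid e';c'\rangle\big)^*;\langle\neg e\mid\neg e'\rangle. \quad(\ast) \] (b) Let $\ddot{\mathbb A}$ be a BiKAT satisfying $(\ast)$ (for all $e,e',c,c',Q,R$ as in (a)). Writing $c\mid c':P\approx>S$ for $P;\langle c\mid c'\rangle;\neg S=0$, the following rule is sound: for tests $e,e'$, actions $c,c'$ and bitests $P,Q,R$, if $c\mid c': P;\langle e\mid e'\rangle;\neg Q;\neg R\approx> P$, $\;c\mid 1: P;Q;\langle e]\approx> P$, $\;1\mid c': P;R;[e'\rangle\approx> P$, and $P\le \langle e\mid e'\rangle+\langle\neg e\mid\neg e'\rangle + Q;\langle e] + R;[e'\rangle$, then $(e;c)^*;\neg e\mid (e';c')^*;\neg e' : P\approx> P;\langle\neg e\mid\neg e'\rangle$.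
   Context: A KAT $(\mathbb A,\mathbb B,+,;,{}^*,\neg,1,0)$ is a Kleene algebra with a Boolean subalgebra $\mathbb B$ of tests; $a\le b$ iff $a+b=b$. A BiKAT over $\mathbb A$ is a KAT $(\ddot{\mathbb A},\ddot{\mathbb B},\dots)$ with KAT homomorphisms $\langle\cdot\,],[\,\cdot\rangle:\mathbb A\to\ddot{\mathbb A}$ (preserving $0,1,+,;,{}^*$, tests and test negation) such that $\langle x];[y\rangle=[y\rangle;\langle x]$ for all $x,y$; $\langle a\mid b\rangle:=\langle a];[b\rangle$; elements of $\ddot{\mathbb B}$ are bitests. A KAT is $*$-continuous if for all $x,y,z$, $x;y^*;z$ is the supremum of $\{x;y^n;z:n\in\mathbb N\}$ ($y^0=1$, $y^{n+1}=y;y^n$); a BiKAT is $*$-continuous if it and its underlying KAT are. *)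

theory Defs
  imports "HOL-Algebra.Ring"
begin

record 'a kat = "'a ring" +
  star :: "'a \<Rightarrow> 'a" ("_\<^sup>\<star>\<index>" [1000] 999)
  tests :: "'a set"
  neg :: "'a \<Rightarrow> 'a" ("\<sim>\<index> _" [81] 80)

definition kat_le :: "[('a, 'm) kat_scheme, 'a, 'a] \<Rightarrow> bool" (infix "\<preceq>\<index>" 50)
  where "x \<preceq>\<^bsub>K\<^esub> y \<longleftrightarrow> x \<oplus>\<^bsub>K\<^esub> y = y"

text \<open>Kozen's axioms. The test axioms say that \<^term>\<open>tests K\<close> is a Boolean algebra under the
  operations of \<^term>\<open>K\<close>; commutativity of the join, the unit laws and the other
  distributive law are inherited from the semiring. The operation \<^term>\<open>neg K\<close> is
  unconstrained outside \<^term>\<open>tests K\<close>.\<close>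

locale kat = semiring K for K (structure) +
  assumes add_idem: "x \<in> carrier K \<Longrightarrow> x \<oplus> x = x"
    and star_closed: "x \<in> carrier K \<Longrightarrow> x\<^sup>\<star> \<in> carrier K"
    and star_unfold_left: "x \<in> carrier K \<Longrightarrow> \<one> \<oplus> x \<otimes> x\<^sup>\<star> \<preceq> x\<^sup>\<star>"
    and star_unfold_right: "x \<in> carrier K \<Longrightarrow> \<one> \<oplus> x\<^sup>\<star> \<otimes> x \<preceq> x\<^sup>\<star>"
    and star_induct_left:
      "\<lbrakk> x \<in> carrier K; y \<in> carrier K; z \<in> carrier K; y \<oplus> x \<otimes> z \<preceq> z \<rbrakk> \<Longrightarrow> x\<^sup>\<star> \<otimes> y \<preceq> z"
    and star_induct_right:
      "\<lbrakk> x \<in> carrier K; y \<in> carrier K; z \<in> carrier K; y \<oplus> z \<otimes> x \<preceq> z \<rbrakk> \<Longrightarrow> y \<otimes> x\<^sup>\<star> \<preceq> z"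
    and tests_subset: "tests K \<subseteq> carrier K"
    and zero_test: "\<zero> \<in> tests K"
    and one_test: "\<one> \<in> tests K"
    and add_test: "\<lbrakk> p \<in> tests K; q \<in> tests K \<rbrakk> \<Longrightarrow> p \<oplus> q \<in> tests K"
    and mult_test: "\<lbrakk> p \<in> tests K; q \<in> tests K \<rbrakk> \<Longrightarrow> p \<otimes> q \<in> tests K"
    and neg_test: "p \<in> tests K \<Longrightarrow> \<sim> p \<in> tests K"
    and test_mult_comm: "\<lbrakk> p \<in> tests K; q \<in> tests K \<rbrakk> \<Longrightarrow> p \<otimes> q = q \<otimes> p"
    and test_add_mult_distrib:
      "\<lbrakk> p \<in> tests K; q \<in> tests K; r \<in> tests K \<rbrakk> \<Longrightarrow> p \<oplus> q \<otimes> r = (p \<oplus> q) \<otimes> (p \<oplus> r)"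
    and test_add_neg: "p \<in> tests K \<Longrightarrow> p \<oplus> \<sim> p = \<one>"
    and test_mult_neg: "p \<in> tests K \<Longrightarrow> p \<otimes> \<sim> p = \<zero>"

definition kat_hom :: "[('a, 'm) kat_scheme, ('b, 'n) kat_scheme] \<Rightarrow> ('a \<Rightarrow> 'b) set"
  where "kat_hom K L =
    {h. h \<in> ring_hom K L \<and>
        h \<zero>\<^bsub>K\<^esub> = \<zero>\<^bsub>L\<^esub> \<and>
        (\<forall>x \<in> carrier K. h (x\<^sup>\<star>\<^bsub>K\<^esub>) = (h x)\<^sup>\<star>\<^bsub>L\<^esub>) \<and>
        (\<forall>p \<in> tests K. h p \<in> tests L \<and> h (\<sim>\<^bsub>K\<^esub> p) = \<sim>\<^bsub>L\<^esub> (h p))}"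

text \<open>The embeddings \<open>lft\<close> and \<open>rgt\<close> are the left embedding \<open>\<langle>x]\<close> and the right embedding
  \<open>[x\<rangle>\<close>; \<open>D\<close> is the algebra of bi-actions, whose tests are the bitests.\<close>

locale bikat = A: kat A + D: kat D
  for A :: "('a, 'm) kat_scheme" and D :: "('b, 'n) kat_scheme" +
  fixes lft :: "'a \<Rightarrow> 'b" and rgt :: "'a \<Rightarrow> 'b"
  assumes lft_hom: "lft \<in> kat_hom A D"
    and rgt_hom: "rgt \<in> kat_hom A D"
    and lft_rgt_comm:
      "\<lbrakk> x \<in> carrier A; y \<in> carrier A \<rbrakk> \<Longrightarrow> lft x \<otimes>\<^bsub>D\<^esub> rgt y = rgt y \<otimes>\<^bsub>D\<^esub> lft x"

definition kat_is_sup :: "[('a, 'm) kat_scheme, 'a, 'a set] \<Rightarrow> bool"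
  where "kat_is_sup K s X \<longleftrightarrow>
    s \<in> carrier K \<and> (\<forall>x \<in> X. x \<preceq>\<^bsub>K\<^esub> s) \<and>
    (\<forall>u \<in> carrier K. (\<forall>x \<in> X. x \<preceq>\<^bsub>K\<^esub> u) \<longrightarrow> s \<preceq>\<^bsub>K\<^esub> u)"

definition star_continuous :: "('a, 'm) kat_scheme \<Rightarrow> bool"
  where "star_continuous K \<longleftrightarrow>
    (\<forall>x \<in> carrier K. \<forall>y \<in> carrier K. \<forall>z \<in> carrier K.
      kat_is_sup K (x \<otimes>\<^bsub>K\<^esub> y\<^sup>\<star>\<^bsub>K\<^esub> \<otimes>\<^bsub>K\<^esub> z) {x \<otimes>\<^bsub>K\<^esub> (y [^]\<^bsub>K\<^esub> n) \<otimes>\<^bsub>K\<^esub> z | n :: nat. True})"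

definition star_continuous_bikat :: "[('a, 'm) kat_scheme, ('b, 'n) kat_scheme] \<Rightarrow> bool"
  where "star_continuous_bikat A D \<longleftrightarrow> star_continuous A \<and> star_continuous D"

text \<open>\<open>\<langle>a | b\<rangle> = \<langle>a];[b\<rangle>\<close>\<close>

definition bipair :: "[('b, 'n) kat_scheme, 'a \<Rightarrow> 'b, 'a \<Rightarrow> 'b, 'a, 'a] \<Rightarrow> 'b"
  where "bipair D lft rgt a b = lft a \<otimes>\<^bsub>D\<^esub> rgt b"

text \<open>The relational judgment \<open>c | c' : P \<approx>> S\<close>.\<close>

definition bijudge ::
    "[('b, 'n) kat_scheme, 'a \<Rightarrow> 'b, 'a \<Rightarrow> 'b, 'a, 'a, 'b, 'b] \<Rightarrow> bool"
  where "bijudge D lft rgt c c' P S \<longleftrightarrow>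
    P \<otimes>\<^bsub>D\<^esub> bipair D lft rgt c c' \<otimes>\<^bsub>D\<^esub> (\<sim>\<^bsub>D\<^esub> S) = \<zero>\<^bsub>D\<^esub>"

text \<open>Expansion of a pair of loops, aligned conditionally on the bitests \<open>Q\<close> and \<open>R\<close>.\<close>

definition loop_expansion ::
    "[('a, 'm) kat_scheme, ('b, 'n) kat_scheme, 'a \<Rightarrow> 'b, 'a \<Rightarrow> 'b,
      'a, 'a, 'a, 'a, 'b, 'b] \<Rightarrow> bool"
  where "loop_expansion A D lft rgt e e' c c' Q R \<longleftrightarrow>
    (lft (e \<otimes>\<^bsub>A\<^esub> c))\<^sup>\<star>\<^bsub>D\<^esub> \<otimes>\<^bsub>D\<^esub> lft (\<sim>\<^bsub>A\<^esub> e) \<otimes>\<^bsub>D\<^esub>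
      (rgt (e' \<otimes>\<^bsub>A\<^esub> c'))\<^sup>\<star>\<^bsub>D\<^esub> \<otimes>\<^bsub>D\<^esub> rgt (\<sim>\<^bsub>A\<^esub> e')
    =
    (Q \<otimes>\<^bsub>D\<^esub> lft (e \<otimes>\<^bsub>A\<^esub> c)
      \<oplus>\<^bsub>D\<^esub> R \<otimes>\<^bsub>D\<^esub> rgt (e' \<otimes>\<^bsub>A\<^esub> c')
      \<oplus>\<^bsub>D\<^esub> (\<sim>\<^bsub>D\<^esub> Q) \<otimes>\<^bsub>D\<^esub> (\<sim>\<^bsub>D\<^esub> R) \<otimes>\<^bsub>D\<^esub> bipair D lft rgt (e \<otimes>\<^bsub>A\<^esub> c) (e' \<otimes>\<^bsub>A\<^esub> c')
      \<oplus>\<^bsub>D\<^esub> (\<sim>\<^bsub>D\<^esub> Q) \<otimes>\<^bsub>D\<^esub> bipair D lft rgt (e \<otimes>\<^bsub>A\<^esub> c) (\<sim>\<^bsub>A\<^esub> e')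
      \<oplus>\<^bsub>D\<^esub> (\<sim>\<^bsub>D\<^esub> R) \<otimes>\<^bsub>D\<^esub> bipair D lft rgt (\<sim>\<^bsub>A\<^esub> e) (e' \<otimes>\<^bsub>A\<^esub> c'))\<^sup>\<star>\<^bsub>D\<^esub>
    \<otimes>\<^bsub>D\<^esub> bipair D lft rgt (\<sim>\<^bsub>A\<^esub> e) (\<sim>\<^bsub>A\<^esub> e')"

end

theory Submission
  imports Defs
begin

text \<open>For part (a), write \<open>a\<close> and \<open>b\<close> for the two loop bodies and \<open>p\<close>, \<open>q\<close> for the two exit tests.
  Since left and right embeddings commute, the left-hand side is \<open>a\<^sup>*;b\<^sup>*;p;q\<close>, and every summand
  of the expanded body lies below \<open>a\<close>, \<open>b\<close> or \<open>a;b\<close>, so the right-hand side is below the left one.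
  Conversely, \<open>a\<^sup>m;b\<^sup>n;p;q\<close> lies below the right-hand side by induction on \<open>m + n\<close>, splitting each
  word by the cases \<open>Q\<close>, \<open>R\<close>, \<open>\<not>Q;\<not>R\<close>; star-continuity then passes to the supremum.
  For part (b), \<open>P\<close> is an invariant of the expanded body: the judgments handle its first three
  summands, and the covering hypothesis on \<open>P\<close> makes the last two unreachable from \<open>P\<close>.\<close>

section \<open>Order and test calculus in a Kleene algebra with tests\<close>

context kat
begin

lemma test_closed: "p \<in> tests K \<Longrightarrow> p \<in> carrier K"
  using tests_subset by blast

lemma neg_closed: "p \<in> tests K \<Longrightarrow> \<sim> p \<in> carrier K"
  by (simp add: neg_test test_closed)

lemma le_refl: "x \<in> carrier K \<Longrightarrow> x \<preceq> x"
  by (simp add: kat_le_def add_idem)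

lemma le_trans:
  "\<lbrakk> x \<preceq> y; y \<preceq> z; x \<in> carrier K; y \<in> carrier K; z \<in> carrier K \<rbrakk> \<Longrightarrow> x \<preceq> z"
  unfolding kat_le_def by (metis a_assoc)

lemma le_antisym:
  "\<lbrakk> x \<preceq> y; y \<preceq> x; x \<in> carrier K; y \<in> carrier K \<rbrakk> \<Longrightarrow> x = y"
  unfolding kat_le_def by (metis a_comm)

lemma le_add1: "\<lbrakk> x \<in> carrier K; y \<in> carrier K \<rbrakk> \<Longrightarrow> x \<preceq> x \<oplus> y"
  unfolding kat_le_def by (metis a_assoc add_idem)

lemma le_add2: "\<lbrakk> x \<in> carrier K; y \<in> carrier K \<rbrakk> \<Longrightarrow> y \<preceq> x \<oplus> y"
  by (metis a_comm le_add1)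

lemma add_le:
  "\<lbrakk> x \<preceq> z; y \<preceq> z; x \<in> carrier K; y \<in> carrier K; z \<in> carrier K \<rbrakk> \<Longrightarrow> x \<oplus> y \<preceq> z"
  unfolding kat_le_def by (simp add: a_assoc)

lemma le_addI1:
  "\<lbrakk> x \<preceq> y; x \<in> carrier K; y \<in> carrier K; z \<in> carrier K \<rbrakk> \<Longrightarrow> x \<preceq> y \<oplus> z"
  by (meson le_add1 le_trans add.m_closed)

lemma le_addI2:
  "\<lbrakk> x \<preceq> z; x \<in> carrier K; y \<in> carrier K; z \<in> carrier K \<rbrakk> \<Longrightarrow> x \<preceq> y \<oplus> z"
  by (meson le_add2 le_trans add.m_closed)

lemma mult_left_mono:
  "\<lbrakk> x \<preceq> y; x \<in> carrier K; y \<in> carrier K; z \<in> carrier K \<rbrakk> \<Longrightarrow> z \<otimes> x \<preceq> z \<otimes> y"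
  unfolding kat_le_def by (metis r_distr)

lemma mult_right_mono:
  "\<lbrakk> x \<preceq> y; x \<in> carrier K; y \<in> carrier K; z \<in> carrier K \<rbrakk> \<Longrightarrow> x \<otimes> z \<preceq> y \<otimes> z"
  unfolding kat_le_def by (metis l_distr)

lemma mult_mono:
  "\<lbrakk> x \<preceq> x'; y \<preceq> y'; x \<in> carrier K; x' \<in> carrier K; y \<in> carrier K; y' \<in> carrier K \<rbrakk>
    \<Longrightarrow> x \<otimes> y \<preceq> x' \<otimes> y'"
  by (meson le_trans mult_left_mono mult_right_mono m_closed)

lemma le_zero: "\<lbrakk> x \<preceq> \<zero>; x \<in> carrier K \<rbrakk> \<Longrightarrow> x = \<zero>"
  by (simp add: kat_le_def)

lemma test_le_one: "p \<in> tests K \<Longrightarrow> p \<preceq> \<one>"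
  by (metis le_add1 neg_closed test_add_neg test_closed)

lemma test_mult_le: "\<lbrakk> p \<in> tests K; x \<in> carrier K \<rbrakk> \<Longrightarrow> p \<otimes> x \<preceq> x"
  by (metis l_one mult_right_mono one_closed test_closed test_le_one)

lemma mult_test_le: "\<lbrakk> p \<in> tests K; x \<in> carrier K \<rbrakk> \<Longrightarrow> x \<otimes> p \<preceq> x"
  by (metis r_one mult_left_mono one_closed test_closed test_le_one)

lemma test_mult_idem: "p \<in> tests K \<Longrightarrow> p \<otimes> p = p"
  by (metis r_distr r_one r_zero test_add_neg test_mult_neg test_closed neg_closed m_closed)

text \<open>Multiply \<open>\<one> = p \<oplus> \<sim> p\<close> by \<open>x\<close> on the right.
  This is the algebraic form of a case distinction on \<open>p\<close> before running
  \<open>x\<close>.\<close>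

lemma test_split:
  assumes "p \<in> tests K" "x \<in> carrier K"
  shows "x = p \<otimes> x \<oplus> \<sim> p \<otimes> x"
  by (metis assms l_distr l_one neg_closed test_add_neg test_closed)

lemma one_le_star: "x \<in> carrier K \<Longrightarrow> \<one> \<preceq> x\<^sup>\<star>"
  by (meson le_add1 le_trans m_closed one_closed add.m_closed star_closed star_unfold_left)

lemma mult_star_le: "x \<in> carrier K \<Longrightarrow> x \<otimes> x\<^sup>\<star> \<preceq> x\<^sup>\<star>"
  by (meson le_add2 le_trans m_closed one_closed add.m_closed star_closed star_unfold_left)

lemma star_mult_le: "x \<in> carrier K \<Longrightarrow> x\<^sup>\<star> \<otimes> x \<preceq> x\<^sup>\<star>"
  by (meson le_add2 le_trans m_closed one_closed add.m_closed star_closed star_unfold_right)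

section \<open>Invariant tests of a starred body\<close>

text \<open>The hypothesis amounts to \<open>P \<otimes> W = P \<otimes> W \<otimes> P\<close>.
  Hence \<open>W\<^sup>\<star> \<otimes> P\<close> contains \<open>P\<close> and is closed under
  right multiplication by \<open>W\<close>, which is what right star induction asks for.\<close>

lemma invariant_star:
  assumes P: "P \<in> tests K" and W: "W \<in> carrier K" and inv: "P \<otimes> W \<otimes> \<sim> P = \<zero>"
  shows "P \<otimes> W\<^sup>\<star> \<preceq> W\<^sup>\<star> \<otimes> P"
proof (rule star_induct_right)
  note cl = test_closed[OF P] neg_closed[OF P] W star_closed[OF W]
  have "P \<otimes> W = P \<otimes> W \<otimes> (P \<oplus> \<sim> P)"
    using cl by (simp add: test_add_neg P)
  also have "\<dots> = P \<otimes> W \<otimes> P"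
    using cl inv by (simp add: r_distr)
  finally have PW: "P \<otimes> W = P \<otimes> W \<otimes> P" .
  have "W\<^sup>\<star> \<otimes> P \<otimes> W = W\<^sup>\<star> \<otimes> (P \<otimes> W) \<otimes> P"
    using cl PW by (simp add: m_assoc test_mult_idem P)
  also have "\<dots> \<preceq> W\<^sup>\<star> \<otimes> W \<otimes> P"
    using cl by (intro mult_right_mono mult_left_mono test_mult_le P) auto
  finally have "W\<^sup>\<star> \<otimes> P \<otimes> W \<preceq> W\<^sup>\<star> \<otimes> W \<otimes> P" .
  moreover have "W\<^sup>\<star> \<otimes> W \<otimes> P \<preceq> W\<^sup>\<star> \<otimes> P"
    using cl by (intro mult_right_mono star_mult_le) auto
  ultimately have "W\<^sup>\<star> \<otimes> P \<otimes> W \<preceq> W\<^sup>\<star> \<otimes> P"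
    using cl by (meson le_trans m_closed)
  moreover have "P \<preceq> W\<^sup>\<star> \<otimes> P"
    using mult_right_mono[OF one_le_star[OF W]] cl by fastforce
  ultimately show "P \<oplus> W\<^sup>\<star> \<otimes> P \<otimes> W \<preceq> W\<^sup>\<star> \<otimes> P"
    using cl by (intro add_le) auto
qed (use assms in \<open>auto intro: test_closed star_closed\<close>)

text \<open>Carrying \<open>P\<close> across the star by \<open>invariant_star\<close> puts it next
  to \<open>z\<close>, where \<open>P \<otimes> z\<close> meets its own negation.\<close>

lemma invariant_loop:
  assumes P: "P \<in> tests K" and z: "z \<in> tests K" and W: "W \<in> carrier K"
    and inv: "P \<otimes> W \<otimes> \<sim> P = \<zero>"
  shows "P \<otimes> (W\<^sup>\<star> \<otimes> z) \<otimes> \<sim> (P \<otimes> z) = \<zero>"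
proof -
  note cl = test_closed[OF P] test_closed[OF z] star_closed[OF W]
    neg_closed[OF mult_test[OF P z]]
  have "P \<otimes> W\<^sup>\<star> \<otimes> (z \<otimes> \<sim> (P \<otimes> z)) \<preceq> W\<^sup>\<star> \<otimes> P \<otimes> (z \<otimes> \<sim> (P \<otimes> z))"
    using cl by (intro mult_right_mono invariant_star P W inv) auto
  also have "\<dots> = W\<^sup>\<star> \<otimes> ((P \<otimes> z) \<otimes> \<sim> (P \<otimes> z))"
    using cl by (simp add: m_assoc)
  also have "\<dots> = \<zero>"
    using cl by (simp add: test_mult_neg mult_test P z)
  finally have "P \<otimes> W\<^sup>\<star> \<otimes> (z \<otimes> \<sim> (P \<otimes> z)) = \<zero>"
    using cl by (intro le_zero) auto
  then show ?thesis
    using cl by (simp add: m_assoc)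
qed

text \<open>The leastness half of the supremum property: a bound on all powers is a bound on the
  star.\<close>

lemma star_continuous_le:
  assumes "star_continuous K" "x \<in> carrier K" "y \<in> carrier K" "z \<in> carrier K" "u \<in> carrier K"
    and "\<And>n::nat. x \<otimes> (y [^] n) \<otimes> z \<preceq> u"
  shows "x \<otimes> y\<^sup>\<star> \<otimes> z \<preceq> u"
  using assms unfolding star_continuous_def kat_is_sup_def by blast

section \<open>Expansion of a pair of commuting loops inside a single algebra\<close>

text \<open>The two embeddings are abstracted away: \<open>a\<close> and \<open>q\<close> stand for
  a left body and a right exit test, \<open>b\<close> and \<open>p\<close> for a right body and a
  left exit test. What remains of the BiKAT structure is that letters of opposite sides commute.
  \<open>W\<close> is the body of the expanded loop.\<close>

context
  fixes a b p q Q R W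
  assumes a: "a \<in> carrier K" and b: "b \<in> carrier K"
    and p: "p \<in> tests K" and q: "q \<in> tests K" and Q: "Q \<in> tests K" and R: "R \<in> tests K"
    and ab: "a \<otimes> b = b \<otimes> a" and aq: "a \<otimes> q = q \<otimes> a" and bp: "b \<otimes> p = p \<otimes> b"
  defines "W \<equiv> Q \<otimes> a \<oplus> R \<otimes> b \<oplus> \<sim> Q \<otimes> \<sim> R \<otimes> (a \<otimes> b) \<oplus> \<sim> Q \<otimes> (a \<otimes> q) \<oplus> \<sim> R \<otimes> (p \<otimes> b)"
begin

lemmas expansion_closed = a b test_closed[OF p] test_closed[OF q] test_closed[OF Q] test_closed[OF R]
  neg_closed[OF Q] neg_closed[OF R]

lemma W_closed: "W \<in> carrier K"
  unfolding W_def using expansion_closed by simp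

lemma W_summands:
  "Q \<otimes> a \<preceq> W" "R \<otimes> b \<preceq> W" "\<sim> Q \<otimes> \<sim> R \<otimes> (a \<otimes> b) \<preceq> W"
  "\<sim> Q \<otimes> (a \<otimes> q) \<preceq> W" "\<sim> R \<otimes> (p \<otimes> b) \<preceq> W"
proof -
  note i = le_add2 le_addI1 m_closed add.m_closed expansion_closed
  show "R \<otimes> b \<preceq> W" "\<sim> Q \<otimes> \<sim> R \<otimes> (a \<otimes> b) \<preceq> W"
    "\<sim> Q \<otimes> (a \<otimes> q) \<preceq> W" "\<sim> R \<otimes> (p \<otimes> b) \<preceq> W"
    unfolding W_def by (intro i)+
  show "Q \<otimes> a \<preceq> W"
    unfolding W_def by (intro le_addI1 le_refl m_closed add.m_closed expansion_closed)
qed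

text \<open>In every case a word can be written, or bounded, by a summand of \<open>W\<close>
  followed by a word with fewer letters. The guards \<open>Q\<close> and \<open>R\<close> decide
  which loop moves; once one loop has run out of letters, its exit test supplies the missing factor
  of the summand.\<close>

lemma expansion_word_le:
  fixes m n :: nat
  shows "a [^] m \<otimes> b [^] n \<otimes> (p \<otimes> q) \<preceq> W\<^sup>\<star> \<otimes> (p \<otimes> q)"
proof (induction "m + n" arbitrary: m n rule: less_induct)
  case less
  note cl = expansion_closed W_closed star_closed[OF W_closed]
  define w where "w m n = a [^] m \<otimes> b [^] n \<otimes> (p \<otimes> q)" for m n :: nat
  let ?X = "W\<^sup>\<star> \<otimes> (p \<otimes> q)"
  note IH = less[folded w_def]
  have X: "?X \<in> carrier K" and w: "\<And>m n. w m n \<in> carrier K"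
    unfolding w_def using cl by auto
  have WX: "W \<otimes> ?X \<preceq> ?X"
    using mult_right_mono[OF mult_star_le[OF W_closed]] cl by (simp add: m_assoc)
  \<comment> \<open>The induction step in general form: prefixing a shorter word with anything below
    \<open>W\<close> stays below \<open>?X\<close>, because \<open>?X\<close> absorbs
    \<open>W\<close> on the left.\<close>
  have step: "s \<otimes> w k l \<preceq> ?X" if "s \<preceq> W" "s \<in> carrier K" "k + l < m + n" for s k l
    using mult_mono[OF that(1) IH[OF that(3)]] WX that cl X w by (meson le_trans m_closed)
  have ba: "b \<otimes> a [^] k = a [^] k \<otimes> b" for k :: nat
    using group_commutes_pow[OF ab, of k] cl by simp
  have qa: "q \<otimes> a [^] k = a [^] k \<otimes> q" for k :: nat
    using group_commutes_pow[OF aq, of k] cl by simp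
  have pb: "p \<otimes> b [^] k = b [^] k \<otimes> p" for k :: nat
    using group_commutes_pow[OF bp, of k] cl by simp
  have pq: "p \<otimes> q = q \<otimes> p" "p \<otimes> p = p" "q \<otimes> q = q"
    using cl by (simp_all add: test_mult_comm test_mult_idem p q)
  have wa: "w (Suc k) l = a \<otimes> w k l" for k l
    unfolding w_def using cl nat_pow_Suc2[OF a, of k] by (simp add: m_assoc del: nat_pow_Suc)
  \<comment> \<open>The leading \<open>b\<close> lies behind the block of \<open>a\<close>s and has
    to be commuted past it to reach the front.\<close>
  have wb: "w k (Suc l) = b \<otimes> w k l" for k l
  proof -
    have "b \<otimes> w k l = (b \<otimes> a [^] k) \<otimes> (b [^] l \<otimes> (p \<otimes> q))"
      unfolding w_def using cl by (simp add: m_assoc)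
    also have "\<dots> = w k (Suc l)"
      unfolding w_def using cl nat_pow_Suc2[OF b, of l] by (simp add: ba m_assoc del: nat_pow_Suc)
    finally show ?thesis ..
  qed
  \<comment> \<open>With no \<open>b\<close> left, the final \<open>q\<close> is duplicated by
    idempotence, and the copy moves to the front through the powers of \<open>a\<close>. The fact
    \<open>wp\<close> does the same for \<open>p\<close> when no \<open>a\<close> is left.\<close>
  have wq: "w k 0 = q \<otimes> w k 0" for k
  proof -
    have "q \<otimes> w k 0 = (q \<otimes> a [^] k) \<otimes> (p \<otimes> q)"
      unfolding w_def using cl by (simp add: m_assoc)
    also have "\<dots> = a [^] k \<otimes> ((q \<otimes> q) \<otimes> p)"
      using cl by (simp add: qa pq(1) m_assoc)
    finally show ?thesis
      unfolding w_def using cl by (simp add: pq)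
  qed
  have wp: "w 0 l = p \<otimes> w 0 l" for l
  proof -
    have "p \<otimes> w 0 l = (p \<otimes> b [^] l) \<otimes> (p \<otimes> q)"
      unfolding w_def using cl by (simp add: m_assoc)
    also have "\<dots> = b [^] l \<otimes> ((p \<otimes> p) \<otimes> q)"
      using cl by (simp add: pb m_assoc)
    finally show ?thesis
      unfolding w_def using cl by (simp add: pq)
  qed
  have "w m n \<preceq> ?X"
  proof (cases m)
    case m: 0
    show ?thesis
    proof (cases n)
      case 0
      then show ?thesis
        unfolding w_def using m mult_right_mono[OF one_le_star[OF W_closed], of "p \<otimes> q"] cl by simp
    next
      case n: (Suc l)
      have 1: "R \<otimes> w m n \<preceq> ?X"
        using step[OF W_summands(2), of m l] cl w[of m l] n by (simp add: wb m_assoc)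
      \<comment> \<open>The left loop has finished, so \<open>wp\<close> provides the test
        \<open>p\<close> in front of \<open>b\<close>, matching the last summand of
        \<open>W\<close>.\<close>
      have "\<sim> R \<otimes> w 0 n = \<sim> R \<otimes> (p \<otimes> b) \<otimes> w 0 l"
        using cl w[of 0 l] unfolding n by (subst wp) (simp only: wb m_assoc m_closed)
      then have 2: "\<sim> R \<otimes> w m n \<preceq> ?X"
        using step[OF W_summands(5), of 0 l] cl m n by simp
      show ?thesis
        using add_le[OF 1 2] test_split[OF R w[of m n]] cl X w by simp
    qed
  next
    case m: (Suc k)
    have 1: "Q \<otimes> w m n \<preceq> ?X"
      using step[OF W_summands(1), of k n] cl w[of k n] m by (simp add: wa m_assoc)
    have 2: "\<sim> Q \<otimes> w m n \<preceq> ?X"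
    proof (cases n)
      case n: 0
      \<comment> \<open>The right loop has finished; \<open>q\<close> comes from \<open>wq\<close>
        and is commuted behind \<open>a\<close> to match the fourth summand.\<close>
      have "\<sim> Q \<otimes> w m 0 = \<sim> Q \<otimes> (a \<otimes> q) \<otimes> w k 0"
        using cl w[of k 0] unfolding m by (subst wq) (simp only: aq wa m_assoc m_closed)
      then show ?thesis
        using step[OF W_summands(4), of k 0] cl m n by simp
    next
      case n: (Suc l)
      \<comment> \<open>Under \<open>R\<close> only the right loop moves. The summand is guarded by
        \<open>R\<close> alone, so \<open>\<sim> Q\<close> is dropped, at the cost of an
        inequality.\<close>
      have "\<sim> Q \<otimes> (R \<otimes> w m n) = \<sim> Q \<otimes> (R \<otimes> b \<otimes> w m l)"
        using cl w[of m l] unfolding n by (simp only: wb m_assoc m_closed)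
      also have "\<dots> \<preceq> R \<otimes> b \<otimes> w m l"
        using cl w by (intro test_mult_le neg_test Q) auto
      finally have 3: "\<sim> Q \<otimes> (R \<otimes> w m n) \<preceq> ?X"
        using cl n X w by (auto intro: le_trans[OF _ step[OF W_summands(2), of m l]])
      \<comment> \<open>Neither guard holds, so the two loops move in lockstep and both exponents
        drop.\<close>
      have "\<sim> Q \<otimes> (\<sim> R \<otimes> w m n) = \<sim> Q \<otimes> \<sim> R \<otimes> (a \<otimes> b) \<otimes> w k l"
        using cl w[of k l] unfolding m n ab by (simp only: wa wb m_assoc m_closed)
      then have 4: "\<sim> Q \<otimes> (\<sim> R \<otimes> w m n) \<preceq> ?X"
        using step[OF W_summands(3), of k l] cl m n by simp
      have "\<sim> Q \<otimes> w m n = \<sim> Q \<otimes> (R \<otimes> w m n) \<oplus> \<sim> Q \<otimes> (\<sim> R \<otimes> w m n)"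
        using test_split[OF R w[of m n]] cl w[of m n] by (metis r_distr m_closed)
      then show ?thesis
        using add_le[OF 3 4] cl X w by simp
    qed
    show ?thesis
      using add_le[OF 1 2] test_split[OF Q w[of m n]] cl X w by simp
  qed
  then show ?case
    unfolding w_def .
qed

text \<open>Upper bound by star-continuity from the bound on words; lower bound by left star
  induction, since the left-hand side absorbs \<open>a\<close>, \<open>b\<close> and hence
  \<open>W\<close>. The commutations of the stars are taken as hypotheses because a BiKAT yields
  them directly, by embedding the star of a body.\<close>

lemma loop_pair_expansion:
  assumes sc: "star_continuous K"
    and sab: "a\<^sup>\<star> \<otimes> b = b \<otimes> a\<^sup>\<star>" and sbp: "b\<^sup>\<star> \<otimes> p = p \<otimes> b\<^sup>\<star>"
  shows "a\<^sup>\<star> \<otimes> p \<otimes> b\<^sup>\<star> \<otimes> q = W\<^sup>\<star> \<otimes> (p \<otimes> q)"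
proof -
  note cl = expansion_closed W_closed star_closed[OF W_closed] star_closed[OF a] star_closed[OF b]
  define z where "z = a\<^sup>\<star> \<otimes> (b\<^sup>\<star> \<otimes> (p \<otimes> q))"
  have z: "z \<in> carrier K"
    unfolding z_def using cl by simp
  have "a\<^sup>\<star> \<otimes> p \<otimes> b\<^sup>\<star> \<otimes> q = a\<^sup>\<star> \<otimes> (p \<otimes> b\<^sup>\<star>) \<otimes> q"
    using cl by (simp add: m_assoc)
  also have "\<dots> = z"
    unfolding z_def sbp[symmetric] using cl by (simp add: m_assoc)
  finally have lhs: "a\<^sup>\<star> \<otimes> p \<otimes> b\<^sup>\<star> \<otimes> q = z" .
  \<comment> \<open>Star-continuity is used twice: first for \<open>b\<close> behind a fixed power
    of \<open>a\<close>, then for \<open>a\<close>, with \<open>\<one>\<close> as the left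
    context.\<close>
  have "a [^] m \<otimes> b\<^sup>\<star> \<otimes> (p \<otimes> q) \<preceq> W\<^sup>\<star> \<otimes> (p \<otimes> q)" for m :: nat
    using cl by (intro star_continuous_le sc expansion_word_le) auto
  then have "\<one> \<otimes> a\<^sup>\<star> \<otimes> (b\<^sup>\<star> \<otimes> (p \<otimes> q)) \<preceq> W\<^sup>\<star> \<otimes> (p \<otimes> q)"
    using cl by (intro star_continuous_le sc) (auto simp: m_assoc)
  then have le: "z \<preceq> W\<^sup>\<star> \<otimes> (p \<otimes> q)"
    unfolding z_def using cl by simp
  have az: "a \<otimes> z \<preceq> z"
    unfolding z_def using mult_right_mono[OF mult_star_le[OF a]] cl by (simp add: m_assoc)
  \<comment> \<open>Commuting \<open>b\<close> past \<open>a\<^sup>\<star>\<close> brings it to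
    \<open>b\<^sup>\<star>\<close>, which absorbs it.\<close>
  have "b \<otimes> z = (b \<otimes> a\<^sup>\<star>) \<otimes> (b\<^sup>\<star> \<otimes> (p \<otimes> q))"
    unfolding z_def using cl by (simp add: m_assoc)
  also have "\<dots> = a\<^sup>\<star> \<otimes> (b \<otimes> b\<^sup>\<star> \<otimes> (p \<otimes> q))"
    unfolding sab[symmetric] using cl by (simp add: m_assoc)
  also have "\<dots> \<preceq> z"
    unfolding z_def using cl
    by (intro mult_left_mono)
      (auto simp: m_assoc[symmetric] intro!: mult_right_mono mult_star_le)
  finally have bz: "b \<otimes> z \<preceq> z" .
  have abz: "a \<otimes> b \<otimes> z \<preceq> z"
    using le_trans[OF mult_left_mono[OF bz] az] cl z by (simp add: m_assoc)
  have "\<sim> Q \<otimes> \<sim> R \<otimes> (a \<otimes> b) \<preceq> a \<otimes> b"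
    using cl by (intro test_mult_le mult_test neg_test Q R) auto
  moreover have "\<sim> Q \<otimes> (a \<otimes> q) \<preceq> a"
    using cl by (intro le_trans[OF test_mult_le[OF neg_test[OF Q]] mult_test_le[OF q]]) auto
  moreover have "\<sim> R \<otimes> (p \<otimes> b) \<preceq> b"
    using cl by (intro le_trans[OF test_mult_le[OF neg_test[OF R]] test_mult_le[OF p]]) auto
  ultimately have "W \<preceq> a \<oplus> b \<oplus> a \<otimes> b"
    unfolding W_def using cl
    by (intro add_le) (auto intro: le_addI1 le_addI2 test_mult_le Q R)
  then have "W \<otimes> z \<preceq> (a \<oplus> b \<oplus> a \<otimes> b) \<otimes> z"
    using cl z by (intro mult_right_mono) auto
  moreover have "(a \<oplus> b \<oplus> a \<otimes> b) \<otimes> z \<preceq> z"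
    using az bz abz cl z by (simp add: l_distr add_le)
  ultimately have "W \<otimes> z \<preceq> z"
    using cl z by (meson le_trans m_closed add.m_closed)
  moreover have "p \<otimes> q \<preceq> z"
  proof -
    have "\<one> \<otimes> (\<one> \<otimes> (p \<otimes> q)) \<preceq> z"
      unfolding z_def using cl by (intro mult_mono one_le_star le_refl) auto
    then show ?thesis
      using cl by simp
  qed
  ultimately have "W\<^sup>\<star> \<otimes> (p \<otimes> q) \<preceq> z"
    using cl z by (intro star_induct_left add_le) auto
  with le show ?thesis
    unfolding lhs using cl z by (intro le_antisym) auto
qed

end

end

section \<open>Transfer to BiKATs: loop expansion and soundness of the rule\<close>

lemma kat_homD:
  assumes "h \<in> kat_hom K L"
  shows "x \<in> carrier K \<Longrightarrow> h x \<in> carrier L"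
    and "\<lbrakk> x \<in> carrier K; y \<in> carrier K \<rbrakk> \<Longrightarrow> h (x \<otimes>\<^bsub>K\<^esub> y) = h x \<otimes>\<^bsub>L\<^esub> h y"
    and "h \<one>\<^bsub>K\<^esub> = \<one>\<^bsub>L\<^esub>"
    and "x \<in> carrier K \<Longrightarrow> h (x\<^sup>\<star>\<^bsub>K\<^esub>) = (h x)\<^sup>\<star>\<^bsub>L\<^esub>"
    and "p \<in> tests K \<Longrightarrow> h p \<in> tests L"
    and "p \<in> tests K \<Longrightarrow> h (\<sim>\<^bsub>K\<^esub> p) = \<sim>\<^bsub>L\<^esub> (h p)"
  using assms by (auto simp: kat_hom_def ring_hom_def)

context bikat
begin

lemmas lft_simps = kat_homD[OF lft_hom]
lemmas rgt_simps = kat_homD[OF rgt_hom]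

text \<open>An instance of \<open>loop_pair_expansion\<close> in \<open>D\<close>, with the embedded
  bodies and exit tests. Every commutation comes from \<open>lft_rgt_comm\<close>; for the starred
  ones the star is formed in \<open>A\<close> and then embedded, as the embeddings preserve
  it.\<close>

lemma star_continuous_loop_expansion:
  assumes sc: "star_continuous D"
    and e: "e \<in> tests A" and e': "e' \<in> tests A" and c: "c \<in> carrier A" and c': "c' \<in> carrier A"
    and Q: "Q \<in> tests D" and R: "R \<in> tests D"
  shows "loop_expansion A D lft rgt e e' c c' Q R"
proof -
  note cl = A.test_closed[OF e] A.test_closed[OF e'] c c' A.neg_test[OF e] A.neg_test[OF e']
    A.neg_closed[OF e] A.neg_closed[OF e']
  have x: "e \<otimes>\<^bsub>A\<^esub> c \<in> carrier A" and y: "e' \<otimes>\<^bsub>A\<^esub> c' \<in> carrier A"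
    using cl by auto
  show ?thesis
    unfolding loop_expansion_def bipair_def
  proof (rule D.loop_pair_expansion[OF _ _ _ _ Q R _ _ _ sc])
    show "(lft (e \<otimes>\<^bsub>A\<^esub> c))\<^sup>\<star>\<^bsub>D\<^esub> \<otimes>\<^bsub>D\<^esub> rgt (e' \<otimes>\<^bsub>A\<^esub> c') =
        rgt (e' \<otimes>\<^bsub>A\<^esub> c') \<otimes>\<^bsub>D\<^esub> (lft (e \<otimes>\<^bsub>A\<^esub> c))\<^sup>\<star>\<^bsub>D\<^esub>"
      using lft_rgt_comm[OF A.star_closed[OF x] y] by (simp add: lft_simps x)
    show "(rgt (e' \<otimes>\<^bsub>A\<^esub> c'))\<^sup>\<star>\<^bsub>D\<^esub> \<otimes>\<^bsub>D\<^esub> lft (\<sim>\<^bsub>A\<^esub> e) =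
        lft (\<sim>\<^bsub>A\<^esub> e) \<otimes>\<^bsub>D\<^esub> (rgt (e' \<otimes>\<^bsub>A\<^esub> c'))\<^sup>\<star>\<^bsub>D\<^esub>"
      using lft_rgt_comm[OF _ A.star_closed[OF y], of "\<sim>\<^bsub>A\<^esub> e"] cl by (simp add: rgt_simps y)
  qed (use x y cl in \<open>simp_all add: lft_simps(1,5) rgt_simps(1,5) lft_rgt_comm\<close>)
qed

text \<open>The expansion replaces the two loops by one loop with body \<open>W\<close>, so it
  suffices that \<open>P\<close> is an invariant of \<open>W\<close>. This is checked summand by
  summand in \<open>i1\<close> to \<open>i5\<close>.\<close>

lemma loop_rule_sound:
  assumes exp: "loop_expansion A D lft rgt e e' c c' Q R"
    and e: "e \<in> tests A" and e': "e' \<in> tests A" and c: "c \<in> carrier A" and c': "c' \<in> carrier A"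
    and P: "P \<in> tests D" and Q: "Q \<in> tests D" and R: "R \<in> tests D"
    and both: "bijudge D lft rgt c c'
      (P \<otimes>\<^bsub>D\<^esub> bipair D lft rgt e e' \<otimes>\<^bsub>D\<^esub> (\<sim>\<^bsub>D\<^esub> Q) \<otimes>\<^bsub>D\<^esub> (\<sim>\<^bsub>D\<^esub> R)) P"
    and left: "bijudge D lft rgt c \<one>\<^bsub>A\<^esub> (P \<otimes>\<^bsub>D\<^esub> Q \<otimes>\<^bsub>D\<^esub> lft e) P"
    and right: "bijudge D lft rgt \<one>\<^bsub>A\<^esub> c' (P \<otimes>\<^bsub>D\<^esub> R \<otimes>\<^bsub>D\<^esub> rgt e') P"
    and cover: "P \<preceq>\<^bsub>D\<^esub> bipair D lft rgt e e' \<oplus>\<^bsub>D\<^esub> bipair D lft rgt (\<sim>\<^bsub>A\<^esub> e) (\<sim>\<^bsub>A\<^esub> e')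
      \<oplus>\<^bsub>D\<^esub> Q \<otimes>\<^bsub>D\<^esub> lft e \<oplus>\<^bsub>D\<^esub> R \<otimes>\<^bsub>D\<^esub> rgt e'"
  shows "bijudge D lft rgt
    ((e \<otimes>\<^bsub>A\<^esub> c)\<^sup>\<star>\<^bsub>A\<^esub> \<otimes>\<^bsub>A\<^esub> (\<sim>\<^bsub>A\<^esub> e)) ((e' \<otimes>\<^bsub>A\<^esub> c')\<^sup>\<star>\<^bsub>A\<^esub> \<otimes>\<^bsub>A\<^esub> (\<sim>\<^bsub>A\<^esub> e'))
    P (P \<otimes>\<^bsub>D\<^esub> bipair D lft rgt (\<sim>\<^bsub>A\<^esub> e) (\<sim>\<^bsub>A\<^esub> e'))"
proof -
  define E C F G where "E = lft e" and "C = lft c" and "F = rgt e'" and "G = rgt c'"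
  note acl = A.test_closed[OF e] A.test_closed[OF e'] c c' A.neg_closed[OF e] A.neg_closed[OF e']
    A.one_closed
  have E: "E \<in> tests D" and F: "F \<in> tests D" and C: "C \<in> carrier D" and G: "G \<in> carrier D"
    and nE: "lft (\<sim>\<^bsub>A\<^esub> e) = \<sim>\<^bsub>D\<^esub> E" and nF: "rgt (\<sim>\<^bsub>A\<^esub> e') = \<sim>\<^bsub>D\<^esub> F"
    unfolding E_def C_def F_def G_def by (simp_all add: lft_simps rgt_simps e e' acl)
  have CF: "C \<otimes>\<^bsub>D\<^esub> F = F \<otimes>\<^bsub>D\<^esub> C"
    unfolding C_def F_def by (simp add: lft_rgt_comm acl)
  have CnF: "C \<otimes>\<^bsub>D\<^esub> \<sim>\<^bsub>D\<^esub> F = \<sim>\<^bsub>D\<^esub> F \<otimes>\<^bsub>D\<^esub> C"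
    using lft_rgt_comm[OF c acl(6)] by (simp add: C_def nF)
  note tests = P Q R E F D.neg_test[OF P] D.neg_test[OF Q] D.neg_test[OF R] D.neg_test[OF E]
    D.neg_test[OF F]
  note cl = tests[THEN D.test_closed] C G
  define W where "W = Q \<otimes>\<^bsub>D\<^esub> (E \<otimes>\<^bsub>D\<^esub> C) \<oplus>\<^bsub>D\<^esub> R \<otimes>\<^bsub>D\<^esub> (F \<otimes>\<^bsub>D\<^esub> G)
    \<oplus>\<^bsub>D\<^esub> \<sim>\<^bsub>D\<^esub> Q \<otimes>\<^bsub>D\<^esub> \<sim>\<^bsub>D\<^esub> R \<otimes>\<^bsub>D\<^esub> (E \<otimes>\<^bsub>D\<^esub> C \<otimes>\<^bsub>D\<^esub> (F \<otimes>\<^bsub>D\<^esub> G))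
    \<oplus>\<^bsub>D\<^esub> \<sim>\<^bsub>D\<^esub> Q \<otimes>\<^bsub>D\<^esub> (E \<otimes>\<^bsub>D\<^esub> C \<otimes>\<^bsub>D\<^esub> \<sim>\<^bsub>D\<^esub> F) \<oplus>\<^bsub>D\<^esub> \<sim>\<^bsub>D\<^esub> R \<otimes>\<^bsub>D\<^esub> (\<sim>\<^bsub>D\<^esub> E \<otimes>\<^bsub>D\<^esub> (F \<otimes>\<^bsub>D\<^esub> G))"
  have W: "W \<in> carrier D"
    unfolding W_def using cl by simp
  let ?B = "E \<otimes>\<^bsub>D\<^esub> F \<oplus>\<^bsub>D\<^esub> \<sim>\<^bsub>D\<^esub> E \<otimes>\<^bsub>D\<^esub> \<sim>\<^bsub>D\<^esub> F \<oplus>\<^bsub>D\<^esub> Q \<otimes>\<^bsub>D\<^esub> E \<oplus>\<^bsub>D\<^esub> R \<otimes>\<^bsub>D\<^esub> F"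
  have B: "P \<preceq>\<^bsub>D\<^esub> ?B"
    using cover by (simp add: bipair_def nE nF E_def F_def)
  \<comment> \<open>On right-nested products \<open>lc\<close> exchanges adjacent tests and
    \<open>ann\<close> removes a test meeting its negation. Below, \<open>lc\<close> is used in
    explicit instances, which fix the direction of each exchange.\<close>
  have lc: "x \<otimes>\<^bsub>D\<^esub> (y \<otimes>\<^bsub>D\<^esub> u) = y \<otimes>\<^bsub>D\<^esub> (x \<otimes>\<^bsub>D\<^esub> u)"
    if "x \<in> tests D" "y \<in> tests D" "u \<in> carrier D" for x y u
    using that by (metis D.m_assoc D.test_closed D.test_mult_comm)
  have ann: "x \<otimes>\<^bsub>D\<^esub> (\<sim>\<^bsub>D\<^esub> x \<otimes>\<^bsub>D\<^esub> u) = \<zero>\<^bsub>D\<^esub>" "\<sim>\<^bsub>D\<^esub> x \<otimes>\<^bsub>D\<^esub> (x \<otimes>\<^bsub>D\<^esub> u) = \<zero>\<^bsub>D\<^esub>"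
    if "x \<in> tests D" "u \<in> carrier D" for x u
    using that by (metis D.m_assoc D.test_closed D.test_mult_comm D.test_mult_neg D.l_null D.neg_test)+
  have ann': "\<sim>\<^bsub>D\<^esub> x \<otimes>\<^bsub>D\<^esub> x = \<zero>\<^bsub>D\<^esub>" if "x \<in> tests D" for x
    using that by (metis D.test_mult_comm D.test_mult_neg D.neg_test)
  have i1: "P \<otimes>\<^bsub>D\<^esub> (Q \<otimes>\<^bsub>D\<^esub> (E \<otimes>\<^bsub>D\<^esub> (C \<otimes>\<^bsub>D\<^esub> \<sim>\<^bsub>D\<^esub> P))) = \<zero>\<^bsub>D\<^esub>"
    using left cl by (simp add: bijudge_def bipair_def rgt_simps E_def C_def D.m_assoc)
  have i2: "P \<otimes>\<^bsub>D\<^esub> (R \<otimes>\<^bsub>D\<^esub> (F \<otimes>\<^bsub>D\<^esub> (G \<otimes>\<^bsub>D\<^esub> \<sim>\<^bsub>D\<^esub> P))) = \<zero>\<^bsub>D\<^esub>"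
    using right cl by (simp add: bijudge_def bipair_def lft_simps F_def G_def D.m_assoc)
  have i3: "P \<otimes>\<^bsub>D\<^esub> (\<sim>\<^bsub>D\<^esub> Q \<otimes>\<^bsub>D\<^esub> (\<sim>\<^bsub>D\<^esub> R \<otimes>\<^bsub>D\<^esub> (E \<otimes>\<^bsub>D\<^esub> (C \<otimes>\<^bsub>D\<^esub> (F \<otimes>\<^bsub>D\<^esub> (G \<otimes>\<^bsub>D\<^esub> \<sim>\<^bsub>D\<^esub> P)))))) = \<zero>\<^bsub>D\<^esub>"
  proof -
    \<comment> \<open>The judgment \<open>both\<close> tests \<open>E\<close> and \<open>F\<close>
      before either command runs, whereas in the summand \<open>F\<close> follows \<open>C\<close>.
      As they live on opposite sides, \<open>F\<close> can be moved forward.\<close>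
    have "C \<otimes>\<^bsub>D\<^esub> (F \<otimes>\<^bsub>D\<^esub> (G \<otimes>\<^bsub>D\<^esub> \<sim>\<^bsub>D\<^esub> P)) = F \<otimes>\<^bsub>D\<^esub> (C \<otimes>\<^bsub>D\<^esub> (G \<otimes>\<^bsub>D\<^esub> \<sim>\<^bsub>D\<^esub> P))"
      using CF cl by (metis D.m_assoc D.m_closed)
    moreover have "P \<otimes>\<^bsub>D\<^esub> (E \<otimes>\<^bsub>D\<^esub> (F \<otimes>\<^bsub>D\<^esub> (\<sim>\<^bsub>D\<^esub> Q \<otimes>\<^bsub>D\<^esub> (\<sim>\<^bsub>D\<^esub> R \<otimes>\<^bsub>D\<^esub> (C \<otimes>\<^bsub>D\<^esub> (G \<otimes>\<^bsub>D\<^esub> \<sim>\<^bsub>D\<^esub> P)))))) = \<zero>\<^bsub>D\<^esub>"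
      using both cl by (simp add: bijudge_def bipair_def E_def F_def C_def G_def D.m_assoc)
    ultimately show ?thesis
      using cl tests by (simp add: lc[of "\<sim>\<^bsub>D\<^esub> R" E] lc[of "\<sim>\<^bsub>D\<^esub> Q" E] lc[of "\<sim>\<^bsub>D\<^esub> R" F] lc[of "\<sim>\<^bsub>D\<^esub> Q" F])
  qed
  \<comment> \<open>Each of the four disjuncts of the cover contradicts this product: the first and
    last clash with \<open>\<sim> F\<close>, the second with \<open>E\<close>, the third with
    \<open>\<sim> Q\<close>.\<close>
  have "P \<otimes>\<^bsub>D\<^esub> (\<sim>\<^bsub>D\<^esub> Q \<otimes>\<^bsub>D\<^esub> (E \<otimes>\<^bsub>D\<^esub> \<sim>\<^bsub>D\<^esub> F)) \<preceq>\<^bsub>D\<^esub> ?B \<otimes>\<^bsub>D\<^esub> (\<sim>\<^bsub>D\<^esub> Q \<otimes>\<^bsub>D\<^esub> (E \<otimes>\<^bsub>D\<^esub> \<sim>\<^bsub>D\<^esub> F))"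
    using cl by (intro D.mult_right_mono B) auto
  also have "\<dots> = \<zero>\<^bsub>D\<^esub>"
    using cl tests by (simp add: D.l_distr D.m_assoc ann ann' D.test_mult_neg
        lc[of E "\<sim>\<^bsub>D\<^esub> Q"] lc[of F "\<sim>\<^bsub>D\<^esub> Q"] lc[of "\<sim>\<^bsub>D\<^esub> E" "\<sim>\<^bsub>D\<^esub> Q"]
        lc[of "\<sim>\<^bsub>D\<^esub> F" "\<sim>\<^bsub>D\<^esub> Q"] lc[of F E] lc[of "\<sim>\<^bsub>D\<^esub> F" E])
  finally have n4: "P \<otimes>\<^bsub>D\<^esub> (\<sim>\<^bsub>D\<^esub> Q \<otimes>\<^bsub>D\<^esub> (E \<otimes>\<^bsub>D\<^esub> \<sim>\<^bsub>D\<^esub> F)) = \<zero>\<^bsub>D\<^esub>"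
    using cl by (intro D.le_zero) auto
  \<comment> \<open>The mirror image: the first and third disjuncts clash with
    \<open>\<sim> E\<close>, the second with \<open>F\<close>, the last with
    \<open>\<sim> R\<close>.\<close>
  have "P \<otimes>\<^bsub>D\<^esub> (\<sim>\<^bsub>D\<^esub> R \<otimes>\<^bsub>D\<^esub> (\<sim>\<^bsub>D\<^esub> E \<otimes>\<^bsub>D\<^esub> F)) \<preceq>\<^bsub>D\<^esub> ?B \<otimes>\<^bsub>D\<^esub> (\<sim>\<^bsub>D\<^esub> R \<otimes>\<^bsub>D\<^esub> (\<sim>\<^bsub>D\<^esub> E \<otimes>\<^bsub>D\<^esub> F))"
    using cl by (intro D.mult_right_mono B) auto
  also have "\<dots> = \<zero>\<^bsub>D\<^esub>"
    using cl tests by (simp add: D.l_distr D.m_assoc ann ann' D.test_mult_neg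
        lc[of E "\<sim>\<^bsub>D\<^esub> R"] lc[of F "\<sim>\<^bsub>D\<^esub> R"] lc[of "\<sim>\<^bsub>D\<^esub> E" "\<sim>\<^bsub>D\<^esub> R"]
        lc[of "\<sim>\<^bsub>D\<^esub> F" "\<sim>\<^bsub>D\<^esub> R"] lc[of F "\<sim>\<^bsub>D\<^esub> E"] lc[of "\<sim>\<^bsub>D\<^esub> F" "\<sim>\<^bsub>D\<^esub> E"])
  finally have n5: "P \<otimes>\<^bsub>D\<^esub> (\<sim>\<^bsub>D\<^esub> R \<otimes>\<^bsub>D\<^esub> (\<sim>\<^bsub>D\<^esub> E \<otimes>\<^bsub>D\<^esub> F)) = \<zero>\<^bsub>D\<^esub>"
    using cl by (intro D.le_zero) auto
  have i4: "P \<otimes>\<^bsub>D\<^esub> (\<sim>\<^bsub>D\<^esub> Q \<otimes>\<^bsub>D\<^esub> (E \<otimes>\<^bsub>D\<^esub> (C \<otimes>\<^bsub>D\<^esub> (\<sim>\<^bsub>D\<^esub> F \<otimes>\<^bsub>D\<^esub> \<sim>\<^bsub>D\<^esub> P)))) = \<zero>\<^bsub>D\<^esub>"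
  proof -
    \<comment> \<open>The exit test of the right loop stands behind the left command here; commuting
      it forward exposes the product annihilated by \<open>n4\<close>.\<close>
    have "C \<otimes>\<^bsub>D\<^esub> (\<sim>\<^bsub>D\<^esub> F \<otimes>\<^bsub>D\<^esub> \<sim>\<^bsub>D\<^esub> P) = \<sim>\<^bsub>D\<^esub> F \<otimes>\<^bsub>D\<^esub> (C \<otimes>\<^bsub>D\<^esub> \<sim>\<^bsub>D\<^esub> P)"
      using CnF cl by (metis D.m_assoc)
    moreover have "P \<otimes>\<^bsub>D\<^esub> (\<sim>\<^bsub>D\<^esub> Q \<otimes>\<^bsub>D\<^esub> (E \<otimes>\<^bsub>D\<^esub> \<sim>\<^bsub>D\<^esub> F)) \<otimes>\<^bsub>D\<^esub> (C \<otimes>\<^bsub>D\<^esub> \<sim>\<^bsub>D\<^esub> P) = \<zero>\<^bsub>D\<^esub>"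
      using cl by (simp add: n4)
    ultimately show ?thesis
      using cl by (simp add: D.m_assoc)
  qed
  have i5: "P \<otimes>\<^bsub>D\<^esub> (\<sim>\<^bsub>D\<^esub> R \<otimes>\<^bsub>D\<^esub> (\<sim>\<^bsub>D\<^esub> E \<otimes>\<^bsub>D\<^esub> (F \<otimes>\<^bsub>D\<^esub> (G \<otimes>\<^bsub>D\<^esub> \<sim>\<^bsub>D\<^esub> P)))) = \<zero>\<^bsub>D\<^esub>"
  proof -
    have "P \<otimes>\<^bsub>D\<^esub> (\<sim>\<^bsub>D\<^esub> R \<otimes>\<^bsub>D\<^esub> (\<sim>\<^bsub>D\<^esub> E \<otimes>\<^bsub>D\<^esub> F)) \<otimes>\<^bsub>D\<^esub> (G \<otimes>\<^bsub>D\<^esub> \<sim>\<^bsub>D\<^esub> P) = \<zero>\<^bsub>D\<^esub>"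
      using cl by (simp add: n5)
    then show ?thesis
      using cl by (simp add: D.m_assoc)
  qed
  have inv: "P \<otimes>\<^bsub>D\<^esub> W \<otimes>\<^bsub>D\<^esub> \<sim>\<^bsub>D\<^esub> P = \<zero>\<^bsub>D\<^esub>"
    unfolding W_def using cl by (simp add: D.l_distr D.r_distr D.m_assoc i1 i2 i3 i4 i5)
  have "lft ((e \<otimes>\<^bsub>A\<^esub> c)\<^sup>\<star>\<^bsub>A\<^esub> \<otimes>\<^bsub>A\<^esub> (\<sim>\<^bsub>A\<^esub> e)) \<otimes>\<^bsub>D\<^esub> rgt ((e' \<otimes>\<^bsub>A\<^esub> c')\<^sup>\<star>\<^bsub>A\<^esub> \<otimes>\<^bsub>A\<^esub> (\<sim>\<^bsub>A\<^esub> e'))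
    = W\<^sup>\<star>\<^bsub>D\<^esub> \<otimes>\<^bsub>D\<^esub> (\<sim>\<^bsub>D\<^esub> E \<otimes>\<^bsub>D\<^esub> \<sim>\<^bsub>D\<^esub> F)"
    using exp acl cl
    by (simp add: loop_expansion_def bipair_def lft_simps(2,4) rgt_simps(2,4) A.star_closed
        D.star_closed nE nF D.m_assoc W_def flip: E_def C_def F_def G_def)
  \<comment> \<open>\<open>invariant_loop\<close> is applied with the joint exit test
    \<open>\<sim> E \<otimes> \<sim> F\<close> as \<open>z\<close>.\<close>
  then show ?thesis
    using D.invariant_loop[OF P D.mult_test[OF D.neg_test[OF E] D.neg_test[OF F]] W inv]
    by (simp add: bijudge_def bipair_def nE nF)
qed

end

theorem theorem6p2:
  fixes A :: "('a, 'm) kat_scheme" and D :: "('b, 'n) kat_scheme"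
    and lft rgt :: "'a \<Rightarrow> 'b"
  assumes "bikat A D lft rgt"
  shows "(star_continuous_bikat A D \<longrightarrow>
      (\<forall>e \<in> tests A. \<forall>e' \<in> tests A. \<forall>c \<in> carrier A. \<forall>c' \<in> carrier A.
        \<forall>Q \<in> tests D. \<forall>R \<in> tests D. loop_expansion A D lft rgt e e' c c' Q R))
    \<and>
    ((\<forall>e \<in> tests A. \<forall>e' \<in> tests A. \<forall>c \<in> carrier A. \<forall>c' \<in> carrier A.
        \<forall>Q \<in> tests D. \<forall>R \<in> tests D. loop_expansion A D lft rgt e e' c c' Q R) \<longrightarrow>
      (\<forall>e \<in> tests A. \<forall>e' \<in> tests A. \<forall>c \<in> carrier A. \<forall>c' \<in> carrier A.
        \<forall>P \<in> tests D. \<forall>Q \<in> tests D. \<forall>R \<in> tests D.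
          bijudge D lft rgt c c'
            (P \<otimes>\<^bsub>D\<^esub> bipair D lft rgt e e' \<otimes>\<^bsub>D\<^esub> (\<sim>\<^bsub>D\<^esub> Q) \<otimes>\<^bsub>D\<^esub> (\<sim>\<^bsub>D\<^esub> R)) P \<longrightarrow>
          bijudge D lft rgt c \<one>\<^bsub>A\<^esub> (P \<otimes>\<^bsub>D\<^esub> Q \<otimes>\<^bsub>D\<^esub> lft e) P \<longrightarrow>
          bijudge D lft rgt \<one>\<^bsub>A\<^esub> c' (P \<otimes>\<^bsub>D\<^esub> R \<otimes>\<^bsub>D\<^esub> rgt e') P \<longrightarrow>
          P \<preceq>\<^bsub>D\<^esub> bipair D lft rgt e e' \<oplus>\<^bsub>D\<^esub> bipair D lft rgt (\<sim>\<^bsub>A\<^esub> e) (\<sim>\<^bsub>A\<^esub> e')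
                  \<oplus>\<^bsub>D\<^esub> Q \<otimes>\<^bsub>D\<^esub> lft e \<oplus>\<^bsub>D\<^esub> R \<otimes>\<^bsub>D\<^esub> rgt e' \<longrightarrow>
          bijudge D lft rgt
            ((e \<otimes>\<^bsub>A\<^esub> c)\<^sup>\<star>\<^bsub>A\<^esub> \<otimes>\<^bsub>A\<^esub> (\<sim>\<^bsub>A\<^esub> e)) ((e' \<otimes>\<^bsub>A\<^esub> c')\<^sup>\<star>\<^bsub>A\<^esub> \<otimes>\<^bsub>A\<^esub> (\<sim>\<^bsub>A\<^esub> e'))
            P (P \<otimes>\<^bsub>D\<^esub> bipair D lft rgt (\<sim>\<^bsub>A\<^esub> e) (\<sim>\<^bsub>A\<^esub> e'))))"
proof -
  interpret bikat A D lft rgt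
    by fact
  show ?thesis
    unfolding star_continuous_bikat_def
    by (intro conjI impI ballI)
      (auto intro: star_continuous_loop_expansion, rule loop_rule_sound, blast+)
qed

end
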